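(* Let $\mathbb{P}_{\Delta}$ be a complete simplicial toric variety of dimension $n$, with homogeneous coordinates $z_1,\ldots,z_{n+r}$. Let $\mathcal{F}$ be a one-dimensional holomorphic foliation on $\mathbb{P}_{\Delta}$ and let $X$ be a quasi-homogeneous vector field which defines $\mathcal{F}$ in homogeneous coordinates. Let $V=\{f=0\}\subset\mathbb{P}_{\Delta}$ be a quasi-smooth hypersurface. Suppose there are integers $1\leq i_1<\cdots<i_k\leq n+r$ such that (i) there is a regular subsequence $\left\{\frac{\partial f}{\partial z_{i_1}},\dots,\frac{\partial f}{\partial z_{i_k}}\right\}\subset\left\{\frac{\partial f}{\partial z_{1}},\dots,\frac{\partial f}{\partial z_{n+r}}\right\}$; and (ii) there is a radial vector field $R_{i_1,\ldots,i_k}=\sum_{j=1}^{k} a_{i_j}z_{i_j}\frac{\partial}{\partial z_{i_j}}$ such that $i_{R_{i_1,\ldots,i_k}}(df)=\theta(\alpha)\cdot f$, where $\alpha\in\mathcal{A}_{n-1}(\mathbb{P}_{\Delta})$ is the degree of $f$ and $\theta(\alpha)$ is a constant. Moreover assume that, in homogeneous coordinates, $X=X_1+X_2$, where $X_1=\sum_{j=1}^{k} P_{i_j}\frac{\partial}{\partial z_{i_j}}$ leaves $V$ invariant and such that $X_1\notin \mathrm{Lie}(G)$. Then $$\deg(V)_{\ell} \leq \deg(\mathcal{F})_{\ell} + \max_{1\leq j_1<j_2\leq k} \big\{\deg(z_{i_{j_1}})_{\ell}+ \deg(z_{i_{j_2}})_{\ell}\big\}$$ for each $1\leq \ell\leq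 r$ with the property that $(\deg P)_\ell\geq 0$ for all $P\in \mathrm{S}$, where $\mathrm{S}=\mathbb{C}[z_1,\dots,z_{n+r}]$ is the homogeneous coordinate ring of $\mathbb{P}_{\Delta}$.
   Context: Toric setting: $\Delta$ is a complete simplicial fan in $N\simeq\mathbb{Z}^n$ with rays $\rho_1,\dots,\rho_{n+r}$, where $n_{\rho_j}$ is the generator of $\rho_j\cap N$; $M=\mathrm{Hom}(N,\mathbb{Z})$; $D_j$ is the torus-invariant Weil divisor corresponding to $\rho_j$. The Weil divisor class group $\mathcal{A}_{n-1}(\mathbb{P}_{\Delta})=\mathbb{Z}^{n+r}/\{(\langle m,n_{\rho_j}\rangle)_j: m\in M\}$ is a finitely generated abelian group of rank $r$. The homogeneous coordinate ring $\mathrm{S}=\mathbb{C}[z_1,\dots,z_{n+r}]$ is graded by $\mathcal{A}_{n-1}(\mathbb{P}_{\Delta})$ with $\deg(z_j)=[D_j]$; $\mathrm{S}_\alpha$ is the graded piece of degree $\alpha$, and its elements are called quasi-homogeneous of degree $\alpha$. Let $G=\mathrm{Hom}_{\mathbb{Z}}(\mathcal{A}_{n-1}(\mathbb{P}_{\Delta}),\mathbb{C}^* )$, acting on $\mathbb{C}^{n+r}$ by $g\cdot(t_j)=(g([D_j])t_j)$, and let $\mathcal{Z}\subset\mathbb{C}^{n+r}$ be the common zero set of the monomials $\prod_{\rho_j\notin\sigma(1)}z_j$, $\sigma\in\Delta$, where $\sigma(1)$ is the set of rays of $\sigma$. Then $\mathbb{P}_{\Delta}$ is the geometric quotient $(\mathbb{C}^{n+r}\setminus\mathcal{Z})/G$.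 Multidegrees: write $\mathcal{A}_{n-1}(\mathbb{P}_{\Delta})\simeq\mathbb{Z}^r\oplus(\text{finite abelian group})$. For $1\le \ell\le r$, $(\deg P)_\ell$ denotes the $\ell$-th integer coordinate of $\deg P\in\mathcal{A}_{n-1}(\mathbb{P}_{\Delta})$; similarly for $\deg(V)_\ell$, $\deg(\mathcal{F})_\ell$ and $\deg(z_j)_\ell$. Radial vector fields: if complex numbers $a_1,\dots,a_{n+r}$ satisfy $\sum_j a_jn_{\rho_j}=0$ in $N\otimes\mathbb{C}$, then, with $R=\sum_j a_jz_j\frac{\partial}{\partial z_j}$, for each class $\alpha$ there is a constant $\theta(\alpha)$ such that $i_R(df)=\theta(\alpha)\cdot f$ for every $f\in\mathrm{S}_\alpha$ (Euler formula), where $i_R(df)=R(f)$. Taking $r$ relations among the $n_{\rho_j}$ that are linearly independent over $\mathbb{Z}$ gives $r$ vector fields $R_1,\dots,R_r$ tangent to the orbits of $G$, called the radial vector fields, and $\mathrm{Lie}(G)=\langle R_1,\dots,R_r\rangle$. Foliations: a one-dimensional holomorphic foliation $\mathcal{F}$ of degree $\deg(\mathcal{F})=[\sum_j d_jD_j]$ is a global section of $\mathcal{T}\mathbb{P}_{\Delta}\otimes\mathcal{O}_{\mathbb{P}_{\Delta}}(\sum_j d_jD_j)$, where $\mathcal{T}\mathbb{P}_{\Delta}=\mathcal{H}om(\Omega^1_{\mathbb{P}_{\Delta}},\mathcal{O}_{\mathbb{P}_{\Delta}})$ is the Zariski tangent sheaf, with singular set of codimension at least $2$. Only foliations given in homogeneous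 coordinates by a quasi-homogeneous vector field are considered, that is, by a polynomial vector field $X=\sum_{j=1}^{n+r}P_j\frac{\partial}{\partial z_j}$ with $P_j$ quasi-homogeneous of degree $\deg(\mathcal{F})+\deg(z_j)$, modulo addition of vector fields $\sum_{i=1}^r g_iR_i$. Hypersurfaces: for a quasi-homogeneous polynomial $f$, $V=\{f=0\}\subset\mathbb{P}_{\Delta}$ has degree $\deg(V)=\deg(f)$. It is quasi-smooth if its tangent cone $\{f=0\}$ on $\mathbb{C}^{n+r}\setminus\mathcal{Z}$ is smooth. A vector field $Y$ in homogeneous coordinates leaves $V$ invariant if $Y(f)=g\cdot f$ for some quasi-homogeneous polynomial $g$. *)

theory Defs
  imports "HOL-Analysis.Analysis" "HOL-Algebra.Free_Abelian_Groups" "HOL-Library.Poly_Mapping"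
    "HOL-Library.Extended_Nat"
begin

text \<open>
  Conventions. The lattice \<open>N\<close> is \<open>int ^ 'n\<close>, so \<open>n = CARD('n)\<close> and \<open>N \<otimes> \<real>\<close> is \<open>real ^ 'n\<close>;
  \<open>M\<close> is the group of additive maps \<open>int ^ 'n \<Rightarrow> int\<close>. The rays (equivalently the homogeneous
  coordinates) are indexed by a finite type \<open>'j\<close>, and \<open>u j\<close> is the generator of \<open>\<rho>\<^sub>j \<inter> N\<close>.
  A fan \<open>\<Delta>\<close> is a set of cones in \<open>real ^ 'n\<close>.
\<close>

section \<open>Complete simplicial fans\<close>

definition real_vec :: "int ^ 'n \<Rightarrow> real ^ 'n" where
  "real_vec v = (\<chi> t. real_of_int (v $ t))"

definition rational_polyhedral_cone :: "(real ^ 'n) set \<Rightarrow> bool" where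
  "rational_polyhedral_cone \<sigma> \<longleftrightarrow>
     (\<exists>B :: (int ^ 'n) set. finite B \<and> \<sigma> = convex_cone hull (real_vec ` B))"

definition strongly_convex :: "(real ^ 'n) set \<Rightarrow> bool" where
  "strongly_convex \<sigma> \<longleftrightarrow> \<sigma> \<inter> uminus ` \<sigma> = {0}"

text \<open>The library counts the empty set as a face of every convex set; it is not a cone.\<close>

definition fan :: "(real ^ 'n) set set \<Rightarrow> bool" where
  "fan \<Delta> \<longleftrightarrow> finite \<Delta> \<and> \<Delta> \<noteq> {} \<and>
     (\<forall>\<sigma>\<in>\<Delta>. rational_polyhedral_cone \<sigma> \<and> strongly_convex \<sigma>) \<and>
     (\<forall>\<sigma>\<in>\<Delta>. \<forall>\<tau>. \<tau> face_of \<sigma> \<and> \<tau> \<noteq> {} \<longrightarrow> \<tau> \<in> \<Delta>) \<and>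
     (\<forall>\<sigma>\<in>\<Delta>. \<forall>\<tau>\<in>\<Delta>. (\<sigma> \<inter> \<tau>) face_of \<sigma> \<and> (\<sigma> \<inter> \<tau>) face_of \<tau>)"

definition simplicial :: "(real ^ 'n) set set \<Rightarrow> bool" where
  "simplicial \<Delta> \<longleftrightarrow> (\<forall>\<sigma>\<in>\<Delta>. \<exists>B. finite B \<and> independent B \<and> \<sigma> = convex_cone hull B)"

definition complete_fan :: "(real ^ 'n) set set \<Rightarrow> bool" where
  "complete_fan \<Delta> \<longleftrightarrow> \<Union>\<Delta> = UNIV"

definition ray :: "('j \<Rightarrow> int ^ 'n) \<Rightarrow> 'j \<Rightarrow> (real ^ 'n) set" where
  "ray u j = convex_cone hull {real_vec (u j)}"

definition ray_generators :: "(real ^ 'n) set set \<Rightarrow> ('j \<Rightarrow> int ^ 'n) \<Rightarrow> bool" where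
  "ray_generators \<Delta> u \<longleftrightarrow>
     bij_betw (ray u) UNIV {\<sigma>\<in>\<Delta>. aff_dim \<sigma> = 1} \<and>
     (\<forall>j. {v. real_vec v \<in> ray u j} = range (\<lambda>k::nat. of_nat k *s u j))"

definition complete_simplicial_fan :: "(real ^ 'n) set set \<Rightarrow> ('j \<Rightarrow> int ^ 'n) \<Rightarrow> bool" where
  "complete_simplicial_fan \<Delta> u \<longleftrightarrow>
     fan \<Delta> \<and> simplicial \<Delta> \<and> complete_fan \<Delta> \<and> ray_generators \<Delta> u"

section \<open>The class group\<close>

text \<open>Torus-invariant Weil divisors \<open>\<Sum>\<^sub>j d\<^sub>j D\<^sub>j\<close> form the free abelian group on \<open>'j\<close>;
  its elements are the finitely supported functions \<open>'j \<Rightarrow>\<^sub>0 int\<close>.\<close>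

definition divisor_group :: "('j \<Rightarrow>\<^sub>0 int) monoid" where
  "divisor_group = free_Abelian_group UNIV"

definition principal_divisors :: "('j \<Rightarrow> int ^ 'n) \<Rightarrow> ('j \<Rightarrow>\<^sub>0 int) set" where
  "principal_divisors u =
     {c. \<exists>m :: int ^ 'n \<Rightarrow> int. Modules.additive m \<and> (\<forall>j. Poly_Mapping.lookup c j = m (u j))}"

definition class_group :: "('j \<Rightarrow> int ^ 'n) \<Rightarrow> ('j \<Rightarrow>\<^sub>0 int) set monoid" where
  "class_group u = divisor_group Mod principal_divisors u"

definition divisor_class :: "('j \<Rightarrow> int ^ 'n) \<Rightarrow> ('j \<Rightarrow>\<^sub>0 int) \<Rightarrow> ('j \<Rightarrow>\<^sub>0 int) set" where
  "divisor_class u d = principal_divisors u #>\<^bsub>divisor_group\<^esub> d"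

definition coord_class :: "('j \<Rightarrow> int ^ 'n) \<Rightarrow> 'j \<Rightarrow> ('j \<Rightarrow>\<^sub>0 int) set" where
  "coord_class u j = divisor_class u (Poly_Mapping.single j 1)"

section \<open>The homogeneous coordinate ring\<close>

type_synonym 'j cpoly = "('j \<Rightarrow>\<^sub>0 nat) \<Rightarrow>\<^sub>0 complex"

definition const :: "complex \<Rightarrow> 'j cpoly" where
  "const c = Poly_Mapping.single 0 c"

definition var :: "'j \<Rightarrow> 'j cpoly" where
  "var j = Poly_Mapping.single (Poly_Mapping.single j 1) 1"

definition poly_eval :: "'j::finite cpoly \<Rightarrow> complex ^ 'j \<Rightarrow> complex" where
  "poly_eval p x = (\<Sum>e\<in>Poly_Mapping.keys p.
     Poly_Mapping.lookup p e * (\<Prod>j\<in>UNIV. (x $ j) ^ Poly_Mapping.lookup e j))"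

text \<open>Exponents with \<open>j\<close>-th entry \<open>0\<close> contribute a zero coefficient, so the truncated
  subtraction is harmless.\<close>

definition pderiv_var :: "'j \<Rightarrow> 'j cpoly \<Rightarrow> 'j cpoly" where
  "pderiv_var j p = (\<Sum>e\<in>Poly_Mapping.keys p.
     Poly_Mapping.single (e - Poly_Mapping.single j 1)
       (of_nat (Poly_Mapping.lookup e j) * Poly_Mapping.lookup p e))"

text \<open>The graded piece \<open>S\<^sub>\<alpha>\<close>: the monomial \<open>z\<^sup>e\<close> has degree \<open>[\<Sum>\<^sub>j e\<^sub>j D\<^sub>j]\<close>, i.e. the grading is
  determined by \<open>deg z\<^sub>j = [D\<^sub>j]\<close>.\<close>

definition graded_piece :: "('j \<Rightarrow> int ^ 'n) \<Rightarrow> ('j \<Rightarrow>\<^sub>0 int) set \<Rightarrow> 'j cpoly set" where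
  "graded_piece u \<alpha> =
     {p. \<forall>e\<in>Poly_Mapping.keys p. divisor_class u (Poly_Mapping.map int e) = \<alpha>}"

definition quasi_homogeneous :: "('j \<Rightarrow> int ^ 'n) \<Rightarrow> 'j cpoly \<Rightarrow> bool" where
  "quasi_homogeneous u p \<longleftrightarrow> (\<exists>\<alpha>\<in>carrier (class_group u). p \<in> graded_piece u \<alpha>)"

text \<open>A ring acts on itself by multiplication; \<open>module.span (*) B\<close> is the ideal generated by \<open>B\<close>.\<close>

definition regular_sequence :: "'a::comm_ring_1 list \<Rightarrow> bool" where
  "regular_sequence xs \<longleftrightarrow>
     (\<forall>i<length xs. \<forall>a. a * xs ! i \<in> module.span (*) (set (take i xs)) \<longrightarrow>
        a \<in> module.span (*) (set (take i xs))) \<and>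
     module.span (*) (set xs) \<noteq> UNIV"

section \<open>The toric variety as a quotient\<close>

definition cone_rays :: "('j \<Rightarrow> int ^ 'n) \<Rightarrow> (real ^ 'n) set \<Rightarrow> 'j set" where
  "cone_rays u \<sigma> = {j. ray u j face_of \<sigma>}"

definition irrelevant_locus ::
    "(real ^ 'n) set set \<Rightarrow> ('j::finite \<Rightarrow> int ^ 'n) \<Rightarrow> (complex ^ 'j) set" where
  "irrelevant_locus \<Delta> u = {x. \<forall>\<sigma>\<in>\<Delta>. (\<Prod>j\<in>- cone_rays u \<sigma>. x $ j) = 0}"

definition complex_units :: "complex monoid" where
  "complex_units = \<lparr>carrier = - {0}, mult = (*), one = 1\<rparr>"

definition G_orbit :: "('j::finite \<Rightarrow> int ^ 'n) \<Rightarrow> complex ^ 'j \<Rightarrow> (complex ^ 'j) set" where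
  "G_orbit u x = {(\<chi> j. g (coord_class u j) * x $ j) |g. g \<in> hom (class_group u) complex_units}"

definition toric_variety ::
    "(real ^ 'n) set set \<Rightarrow> ('j::finite \<Rightarrow> int ^ 'n) \<Rightarrow> (complex ^ 'j) set set" where
  "toric_variety \<Delta> u = G_orbit u ` (- irrelevant_locus \<Delta> u)"

definition zariski :: "(complex ^ 'j::finite) topology" where
  "zariski = topology_generated_by (range (\<lambda>p. {x. poly_eval p x \<noteq> 0}))"

text \<open>The quotient of the Zariski topology; the generating family is itself a topology.\<close>

definition toric_topology ::
    "(real ^ 'n) set set \<Rightarrow> ('j::finite \<Rightarrow> int ^ 'n) \<Rightarrow> (complex ^ 'j) set topology" where
  "toric_topology \<Delta> u = topology_generated_by
     {W. W \<subseteq> toric_variety \<Delta> u \<and> openin (subtopology zariski (- irrelevant_locus \<Delta> u)) (\<Union>W)}"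

definition irreducible_closed :: "'a topology \<Rightarrow> 'a set \<Rightarrow> bool" where
  "irreducible_closed T C \<longleftrightarrow> closedin T C \<and> C \<noteq> {} \<and>
     (\<forall>A B. closedin T A \<and> closedin T B \<and> C \<subseteq> A \<union> B \<longrightarrow> C \<subseteq> A \<or> C \<subseteq> B)"

text \<open>For closed \<open>Y\<close> the codimension is the infimum, over irreducible closed \<open>C \<subseteq> Y\<close>, of the
  suprema of lengths of chains of irreducible closed sets starting at \<open>C\<close>. Thus the empty set has
  codimension \<open>\<infinity>\<close>.\<close>

definition codimension :: "'a topology \<Rightarrow> 'a set \<Rightarrow> enat" where
  "codimension T Y = (INF C\<in>{C. irreducible_closed T C \<and> C \<subseteq> Y}.
     SUP k\<in>{k. \<exists>c. c 0 = C \<and> (\<forall>i\<le>k. irreducible_closed T (c i)) \<and> (\<forall>i<k. c i \<subset> c (Suc i))}.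
       enat k)"

section \<open>Vector fields in homogeneous coordinates\<close>

text \<open>\<open>X\<close> stands for \<open>\<Sum>\<^sub>j X\<^sub>j \<partial>/\<partial>z\<^sub>j\<close>.\<close>

type_synonym 'j vfield = "'j \<Rightarrow> 'j cpoly"

definition vf_apply :: "'j::finite vfield \<Rightarrow> 'j cpoly \<Rightarrow> 'j cpoly" where
  "vf_apply X f = (\<Sum>j\<in>UNIV. X j * pderiv_var j f)"

definition quasi_homogeneous_vf ::
    "('j \<Rightarrow> int ^ 'n) \<Rightarrow> ('j \<Rightarrow>\<^sub>0 int) set \<Rightarrow> 'j vfield \<Rightarrow> bool" where
  "quasi_homogeneous_vf u \<beta> X \<longleftrightarrow>
     (\<forall>j. X j \<in> graded_piece u (\<beta> \<otimes>\<^bsub>class_group u\<^esub> coord_class u j))"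

definition ray_relation :: "('j::finite \<Rightarrow> int ^ 'n) \<Rightarrow> ('j \<Rightarrow> complex) \<Rightarrow> bool" where
  "ray_relation u a \<longleftrightarrow> (\<forall>t. (\<Sum>j\<in>UNIV. a j * of_int (u j $ t)) = 0)"

definition radial_vf :: "('j \<Rightarrow> complex) \<Rightarrow> 'j vfield" where
  "radial_vf a = (\<lambda>j. const (a j) * var j)"

definition radial_basis :: "('j::finite \<Rightarrow> int ^ 'n) \<Rightarrow> nat \<Rightarrow> (nat \<Rightarrow> 'j \<Rightarrow> int) \<Rightarrow> bool" where
  "radial_basis u r b \<longleftrightarrow>
     (\<forall>l\<in>{1..r}. (\<Sum>j\<in>UNIV. b l j *s u j) = 0) \<and>
     (\<forall>c :: nat \<Rightarrow> int. (\<forall>j. (\<Sum>l\<in>{1..r}. c l * b l j) = 0) \<longrightarrow> (\<forall>l\<in>{1..r}. c l = 0))"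

text \<open>\<open>Lie(G) = \<langle>R\<^sub>1, \<dots>, R\<^sub>r\<rangle>\<close>, generated over the coordinate ring \<open>S\<close>: these are the vector
  fields \<open>\<Sum>\<^sub>l g\<^sub>l R\<^sub>l\<close> that are tangent to the orbits of \<open>G\<close> and define the zero section of
  the (twisted) tangent sheaf. Over \<open>\<complex>\<close> alone one would miss fields such as \<open>z\<^sub>j R\<^sub>l\<close>.\<close>

definition Lie_G :: "nat \<Rightarrow> (nat \<Rightarrow> 'j \<Rightarrow> int) \<Rightarrow> 'j vfield set" where
  "Lie_G r b = {\<lambda>j. \<Sum>l\<in>{1..r}. g l * radial_vf (\<lambda>j. of_int (b l j)) j |g. True}"

section \<open>Foliations and hypersurfaces\<close>

text \<open>The section defined by \<open>X\<close> vanishes at the point \<open>G\<cdot>x\<close> iff \<open>X(x)\<close> is tangent to the orbit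
  of \<open>x\<close>, i.e. lies in the span of \<open>R\<^sub>1(x), \<dots>, R\<^sub>r(x)\<close>.\<close>

definition singular_set :: "(real ^ 'n) set set \<Rightarrow> ('j::finite \<Rightarrow> int ^ 'n) \<Rightarrow> nat \<Rightarrow>
    (nat \<Rightarrow> 'j \<Rightarrow> int) \<Rightarrow> 'j vfield \<Rightarrow> (complex ^ 'j) set set" where
  "singular_set \<Delta> u r b X = G_orbit u ` {x \<in> - irrelevant_locus \<Delta> u.
     \<exists>c :: nat \<Rightarrow> complex. \<forall>j. poly_eval (X j) x = (\<Sum>l\<in>{1..r}. c l * of_int (b l j) * x $ j)}"

text \<open>A foliation of degree \<open>\<beta>\<close> is identified with the class of quasi-homogeneous vector fields
  defining it, i.e. a quasi-homogeneous vector field modulo \<open>\<Sum>\<^sub>l g\<^sub>l R\<^sub>l\<close>.\<close>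

definition foliation :: "(real ^ 'n) set set \<Rightarrow> ('j::finite \<Rightarrow> int ^ 'n) \<Rightarrow> nat \<Rightarrow>
    (nat \<Rightarrow> 'j \<Rightarrow> int) \<Rightarrow> ('j \<Rightarrow>\<^sub>0 int) set \<Rightarrow> 'j vfield set \<Rightarrow> bool" where
  "foliation \<Delta> u r b \<beta> F \<longleftrightarrow> \<beta> \<in> carrier (class_group u) \<and>
     (\<exists>X. quasi_homogeneous_vf u \<beta> X \<and>
          F = {Y. quasi_homogeneous_vf u \<beta> Y \<and> (\<lambda>j. Y j - X j) \<in> Lie_G r b} \<and>
          codimension (toric_topology \<Delta> u) (singular_set \<Delta> u r b X) \<ge> 2)"

definition quasi_smooth ::
    "(real ^ 'n) set set \<Rightarrow> ('j::finite \<Rightarrow> int ^ 'n) \<Rightarrow> 'j cpoly \<Rightarrow> bool" where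
  "quasi_smooth \<Delta> u f \<longleftrightarrow>
     (\<forall>x\<in>- irrelevant_locus \<Delta> u. poly_eval f x = 0 \<longrightarrow> (\<exists>j. poly_eval (pderiv_var j f) x \<noteq> 0))"

definition leaves_invariant ::
    "('j::finite \<Rightarrow> int ^ 'n) \<Rightarrow> 'j vfield \<Rightarrow> 'j cpoly \<Rightarrow> bool" where
  "leaves_invariant u Y f \<longleftrightarrow> (\<exists>g. quasi_homogeneous u g \<and> vf_apply Y f = g * f)"

section \<open>Multidegrees\<close>

text \<open>For an isomorphism \<open>\<phi>\<close> from the class group onto \<open>\<int>\<^sup>r \<oplus> T\<close>, with \<open>T\<close> finite, this is the
  \<open>l\<close>-th integer coordinate of \<open>\<alpha>\<close>.\<close>

definition multidegree ::
    "(('j \<Rightarrow>\<^sub>0 int) set \<Rightarrow> (nat \<Rightarrow>\<^sub>0 int) \<times> 't) \<Rightarrow> nat \<Rightarrow> ('j \<Rightarrow>\<^sub>0 int) set \<Rightarrow> int" where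
  "multidegree \<phi> l \<alpha> = Poly_Mapping.lookup (fst (\<phi> \<alpha>)) l"

end

theory Submission
  imports Defs
begin

text \<open>
  Fix a coordinate \<open>l\<close> in which all degrees of nonzero polynomials are nonnegative, and write \<open>deg\<close>
  for that coordinate of the multidegree.

  The basic case is a nonzero quasi-homogeneous field \<open>Y = \<Sum>\<^sub>s Q\<^sub>s \<partial>/\<partial>z\<^sub>s\<close> of degree \<open>\<delta>\<close>, supported on
  the chosen variables, with \<open>Y(f) = 0\<close> (\<open>annihilating_field_degree_bound\<close>). Then
  \<open>\<Sum>\<^sub>s Q\<^sub>s \<partial>f/\<partial>z\<^sub>s = 0\<close> is a syzygy of a regular sequence, so each \<open>Q\<^sub>s\<close> lies in the ideal generated
  by the \<open>\<partial>f/\<partial>z\<^sub>t\<close> with \<open>t \<noteq> s\<close> (\<open>regular_sequence_syzygy\<close>). If \<open>Q\<^sub>s \<noteq> 0\<close>, some \<open>t \<noteq> s\<close>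
  satisfies \<open>deg Q\<^sub>s \<ge> deg \<partial>f/\<partial>z\<^sub>t\<close>, that is, \<open>\<delta> + deg z\<^sub>s \<ge> deg f - deg z\<^sub>t\<close>.

  In general \<open>X\<^sub>1(f) = g f\<close>, and there is a nonzero radial field \<open>R\<close> on the same variables with
  \<open>R(f) = \<theta> f\<close>.
  \<^item> If \<open>g f = 0\<close>, the basic case applies to \<open>Y = X\<^sub>1\<close>, which is nonzero because \<open>X\<^sub>1 \<notin> Lie(G)\<close>.
  \<^item> If \<open>g f \<noteq> 0\<close> and \<open>\<theta> \<noteq> 0\<close>, it applies to \<open>Y = X\<^sub>1 - (g/\<theta>) R\<close>. This field is nonzero
    because \<open>(g/\<theta>) R \<in> Lie(G)\<close>: the rays of a complete fan span the space, so the given \<open>r\<close>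
    independent integer relations span all complex relations (\<open>ray_relation_combination\<close>).
  \<^item> If \<open>g f \<noteq> 0\<close> and \<open>\<theta> = 0\<close>, it applies to \<open>Y = R\<close>, which has degree \<open>0\<close>. The resulting bound
    without \<open>deg \<F>\<close> suffices, because comparing degrees in \<open>X\<^sub>1(f) = g f\<close> gives
    \<open>deg \<F> = deg g \<ge> 0\<close>.
\<close>

section \<open>Syzygies of regular sequences\<close>

lemma module_mult: "module ((*) :: 'a::comm_ring_1 \<Rightarrow> 'a \<Rightarrow> 'a)"
  by unfold_locales (auto simp: algebra_simps)

lemma ideal_combination:
  fixes x :: "'b \<Rightarrow> 'a::comm_ring_1"
  assumes "finite J" "y \<in> module.span (*) (x ` J)"
  shows "\<exists>A. y = (\<Sum>t\<in>J. A t * x t)"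
proof -
  interpret m: module "(*) :: 'a \<Rightarrow> 'a \<Rightarrow> 'a" by (rule module_mult)
  show ?thesis
    using assms(2)
  proof (induction rule: m.span_induct_alt)
    case base
    then show ?case by (intro exI[of _ "\<lambda>_. 0"]) simp
  next
    case (step c z w)
    then obtain A s where A: "w = (\<Sum>t\<in>J. A t * x t)" and s: "s \<in> J" "z = x s"
      by blast
    have "c * z + w = (\<Sum>t\<in>J. (if t = s then c * x t else 0) + A t * x t)"
      using A s assms(1) by (simp add: sum.distrib)
    also have "\<dots> = (\<Sum>t\<in>J. (A t + (if t = s then c else 0)) * x t)"
      by (rule sum.cong) (simp_all add: distrib_right)
    finally show ?case by (rule exI[of _ "\<lambda>t. A t + (if t = s then c else 0)"])
  qed
qed

lemma sum_shift_coefficients: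
  fixes q A x :: "'b \<Rightarrow> 'a::comm_ring_1"
  shows "(\<Sum>t\<in>J. (q t + A t * y) * x t) = (\<Sum>t\<in>J. q t * x t) + (\<Sum>t\<in>J. A t * x t) * y"
proof -
  have "(\<Sum>t\<in>J. (q t + A t * y) * x t) = (\<Sum>t\<in>J. q t * x t + A t * x t * y)"
    by (rule sum.cong) (simp_all add: algebra_simps)
  then show ?thesis
    by (simp add: sum.distrib sum_distrib_right)
qed

text \<open>
  Every syzygy of a regular sequence lies in the module of Koszul syzygies; this is the part of that
  fact that bounds degrees. Induction on the length of the prefix: regularity puts the last
  coefficient into the ideal of the earlier entries, \<open>q\<^sub>n = \<Sum>\<^bsub>t<n\<^esub> A\<^sub>t x\<^sub>t\<close>, and substituting
  this gives the shorter syzygy \<open>\<Sum>\<^bsub>t<n\<^esub> (q\<^sub>t + A\<^sub>t x\<^sub>n) x\<^sub>t = 0\<close>.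
\<close>

lemma regular_sequence_syzygy:
  fixes x :: "'a::comm_ring_1 list"
  assumes "regular_sequence x" "(\<Sum>t<length x. q t * x ! t) = 0" "s < length x"
  shows "q s \<in> module.span (*) ((!) x ` ({..<length x} - {s}))"
proof -
  interpret m: module "(*) :: 'a \<Rightarrow> 'a \<Rightarrow> 'a" by (rule module_mult)
  have "\<forall>q. (\<Sum>t<n. q t * x ! t) = 0 \<longrightarrow> (\<forall>s<n. q s \<in> m.span ((!) x ` ({..<n} - {s})))"
    if "n \<le> length x" for n
    using that
  proof (induction n)
    case 0
    then show ?case by simp
  next
    case (Suc n)
    show ?case
    proof (intro allI impI)
      fix q s
      assume q: "(\<Sum>t<Suc n. q t * x ! t) = 0" and s: "s < Suc n"
      have take: "set (take n x) = (!) x ` {..<n}"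
        using Suc.prems by (simp add: nth_image flip: atLeast0LessThan)
      have "q n * x ! n = - (\<Sum>t<n. q t * x ! t)"
        using q by (simp add: eq_neg_iff_add_eq_0 add.commute)
      also have "\<dots> \<in> m.span ((!) x ` {..<n})"
        by (intro m.span_neg m.span_sum m.span_scale m.span_base) auto
      finally have qn: "q n \<in> m.span ((!) x ` {..<n})"
        using assms(1)[unfolded regular_sequence_def, THEN conjunct1, rule_format, of n "q n"]
          Suc.prems take by simp
      show "q s \<in> m.span ((!) x ` ({..<Suc n} - {s}))"
      proof (cases "s = n")
        case True
        have "{..<Suc n} - {n} = {..<n}" by auto
        with True qn show ?thesis by simp
      next
        case False
        with s have "s < n" by simp
        obtain A where A: "q n = (\<Sum>t<n. A t * x ! t)"
          using ideal_combination[OF finite_lessThan qn] by blast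
        have "(\<Sum>t<n. (q t + A t * x ! n) * x ! t) = 0"
          using q A by (simp only: sum_shift_coefficients) simp
        then have "q s + A s * x ! n \<in> m.span ((!) x ` ({..<n} - {s}))"
          using Suc.IH[rule_format, of "\<lambda>t. q t + A t * x ! n" s] Suc.prems \<open>s < n\<close> by simp
        moreover have "m.span ((!) x ` ({..<n} - {s})) \<subseteq> m.span ((!) x ` ({..<Suc n} - {s}))"
          by (intro m.span_mono) auto
        moreover have "A s * x ! n \<in> m.span ((!) x ` ({..<Suc n} - {s}))"
          using False by (intro m.span_scale m.span_base) auto
        ultimately have "q s + A s * x ! n - A s * x ! n \<in> m.span ((!) x ` ({..<Suc n} - {s}))"
          by (intro m.span_diff) (rule subsetD)
        then show ?thesis
          by (simp only: add_diff_cancel_right')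
      qed
    qed
  qed
  from this[OF order_refl, rule_format, OF assms(2,3)] show ?thesis .
qed

section \<open>Weights of vector fields annihilating a polynomial\<close>

lemma keys_pderiv_var:
  assumes "e \<in> Poly_Mapping.keys (pderiv_var j p)"
  shows "e + Poly_Mapping.single j 1 \<in> Poly_Mapping.keys p"
proof -
  obtain d where d: "d \<in> Poly_Mapping.keys p"
    "Poly_Mapping.lookup (Poly_Mapping.single (d - Poly_Mapping.single j 1)
       (of_nat (Poly_Mapping.lookup d j) * Poly_Mapping.lookup p d)) e \<noteq> 0"
    using assms[unfolded pderiv_var_def in_keys_iff[of e] lookup_sum]
    by (rule sum.not_neutral_contains_not_neutral)
  have e: "e = d - Poly_Mapping.single j 1" and "Poly_Mapping.lookup d j \<noteq> 0"
    using d(2) by (auto simp: lookup_single when_def split: if_splits)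
  then have "e + Poly_Mapping.single j 1 = d"
    by (intro poly_mapping_eqI)
      (auto simp: lookup_add lookup_minus lookup_single when_def)
  with d(1) show ?thesis by simp
qed

lemma keys_sum_of_products:
  fixes A x :: "'b \<Rightarrow> 'j cpoly"
  assumes "e \<in> Poly_Mapping.keys (\<Sum>t\<in>J. A t * x t)"
  shows "\<exists>t\<in>J. \<exists>d\<in>Poly_Mapping.keys (A t). \<exists>d'\<in>Poly_Mapping.keys (x t). e = d + d'"
proof -
  obtain t where "t \<in> J" "Poly_Mapping.lookup (A t * x t) e \<noteq> 0"
    using assms[unfolded in_keys_iff[of e] lookup_sum]
    by (rule sum.not_neutral_contains_not_neutral)
  then have "t \<in> J" "e \<in> Poly_Mapping.keys (A t * x t)"
    by (simp_all add: in_keys_iff)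
  with keys_mult[of "A t" "x t"] show ?thesis by blast
qed

text \<open>
  Think of \<open>m\<close> as a degree of monomials with no negative values. A monomial of \<open>Q s\<close> is the product
  of a monomial of some \<open>\<partial>f/\<partial>z\<^sub>t\<close> with \<open>t \<noteq> s\<close>, whose degree is \<open>\<alpha> - deg z\<^sub>t\<close>, and a monomial of
  nonnegative degree. Comparing this with the degree \<open>\<delta> + deg z\<^sub>s\<close> of \<open>Q s\<close> gives the bound.
\<close>

lemma syzygy_degree_bound:
  fixes m :: "('j \<Rightarrow>\<^sub>0 nat) \<Rightarrow> int" and f :: "'j cpoly"
  assumes add: "\<And>d e. m (d + e) = m d + m e"
    and nonneg: "\<And>e. 0 \<le> m e"
    and f: "\<And>e. e \<in> Poly_Mapping.keys f \<Longrightarrow> m e = \<alpha>"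
    and regular: "regular_sequence (map (\<lambda>s. pderiv_var (i s) f) [1..<Suc k])"
    and Q: "\<And>e. e \<in> Poly_Mapping.keys (Q s) \<Longrightarrow> m e = \<delta> + m (Poly_Mapping.single (i s) 1)"
    and syzygy: "(\<Sum>t\<in>{1..k}. Q t * pderiv_var (i t) f) = 0"
    and s: "s \<in> {1..k}" "Q s \<noteq> 0"
  obtains t where "t \<in> {1..k}" "t \<noteq> s"
    "\<alpha> \<le> \<delta> + (m (Poly_Mapping.single (i s) 1) + m (Poly_Mapping.single (i t) 1))"
proof -
  let ?f = "\<lambda>t. pderiv_var (i t) f"
  let ?x = "map ?f [1..<Suc k]"
  have nth: "?x ! t = ?f (Suc t)" if "t < k" for t
    using that by (simp del: upt_Suc)
  obtain s' where s': "s = Suc s'" "s' < k"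
    using s(1) by (cases s) auto
  have "(\<Sum>t<k. Q (Suc t) * ?x ! t) = (\<Sum>t<k. Q (Suc t) * ?f (Suc t))"
    by (rule sum.cong) (auto simp: nth simp del: upt_Suc)
  also have "\<dots> = 0"
    using syzygy by (simp add: sum.atLeast1_atMost_eq)
  finally have "Q (Suc s') \<in> module.span (*) ((!) ?x ` ({..<k} - {s'}))"
    using regular_sequence_syzygy[OF regular, of "\<lambda>t. Q (Suc t)" s'] s' by simp
  also have "(!) ?x ` ({..<k} - {s'}) = ?f ` Suc ` ({..<k} - {s'})"
    unfolding image_image by (rule image_cong) (auto simp: nth simp del: upt_Suc)
  also have "Suc ` ({..<k} - {s'}) = {1..k} - {s}"
    unfolding s'(1) by (simp add: image_set_diff image_Suc_lessThan)
  finally obtain A where A: "Q s = (\<Sum>t\<in>{1..k} - {s}. A t * ?f t)"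
    using ideal_combination[of "{1..k} - {s}" "Q s" ?f] s' by auto
  obtain e where e: "e \<in> Poly_Mapping.keys (Q s)"
    using s(2) by (metis all_not_in_conv keys_eq_empty)
  with A obtain t d d' where t: "t \<in> {1..k} - {s}" and d: "d' \<in> Poly_Mapping.keys (?f t)" "e = d + d'"
    using keys_sum_of_products[of e A ?f] by metis
  have "m d' + m (Poly_Mapping.single (i t) 1) = \<alpha>"
    using f[OF keys_pderiv_var[OF d(1)]] by (simp add: add)
  moreover have "m d + m d' = \<delta> + m (Poly_Mapping.single (i s) 1)"
    using Q[OF e] by (simp add: d(2) add)
  ultimately have "\<alpha> \<le> \<delta> + (m (Poly_Mapping.single (i s) 1) + m (Poly_Mapping.single (i t) 1))"
    using nonneg[of d] by linarith
  with t show ?thesis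
    by (intro that[of t]) auto
qed

lemma radial_vf_eq_single: "radial_vf a j = Poly_Mapping.single (Poly_Mapping.single j 1) (a j)"
  by (simp add: radial_vf_def const_def var_def mult_single)

lemma keys_const_mult: "Poly_Mapping.keys (const c * p) \<subseteq> Poly_Mapping.keys p"
  using keys_mult[of "const c" p] by (auto simp: const_def split: if_splits)

lemma vf_apply_supported:
  assumes "finite S" "inj_on i S" "\<And>j. j \<notin> i ` S \<Longrightarrow> Y j = 0"
  shows "vf_apply Y f = (\<Sum>s\<in>S. Y (i s) * pderiv_var (i s) f)"
proof -
  have "vf_apply Y f = (\<Sum>j\<in>i ` S. Y j * pderiv_var j f)"
    unfolding vf_apply_def using assms(3) by (intro sum.mono_neutral_right) auto
  then show ?thesis
    using assms(2) by (simp add: sum.reindex)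
qed

lemma vf_apply_diff_mult:
  "vf_apply (\<lambda>j. X j - h * R j) f = vf_apply X f - h * vf_apply R f"
proof -
  have "vf_apply (\<lambda>j. X j - h * R j) f
      = (\<Sum>j\<in>UNIV. X j * pderiv_var j f - h * (R j * pderiv_var j f))"
    unfolding vf_apply_def by (rule sum.cong) (simp_all add: left_diff_distrib mult.assoc)
  then show ?thesis
    by (simp add: vf_apply_def sum_subtractf sum_distrib_left)
qed

text \<open>
  The bound of the theorem for fields \<open>Y\<close> with \<open>Y(f) = 0\<close>, which are syzygies of the partial
  derivatives. The degree \<open>\<delta>\<close> of \<open>Y\<close> is a parameter, because the bound is used both for
  \<open>\<delta> = deg \<F>\<close> and, when \<open>Y\<close> is a radial field, for \<open>\<delta> = 0\<close>.
\<close>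

lemma annihilating_field_degree_bound:
  fixes m :: "('j::finite \<Rightarrow>\<^sub>0 nat) \<Rightarrow> int" and f :: "'j cpoly"
  assumes add: "\<And>d e. m (d + e) = m d + m e"
    and nonneg: "\<And>e. 0 \<le> m e"
    and f: "\<And>e. e \<in> Poly_Mapping.keys f \<Longrightarrow> m e = \<alpha>"
    and regular: "regular_sequence (map (\<lambda>s. pderiv_var (i s) f) [1..<Suc k])"
    and inj: "inj_on i {1..k}"
    and supp: "\<And>j. j \<notin> i ` {1..k} \<Longrightarrow> Y j = 0"
    and Y: "\<And>j e. e \<in> Poly_Mapping.keys (Y j) \<Longrightarrow> m e = \<delta> + m (Poly_Mapping.single j 1)"
    and zero: "vf_apply Y f = 0" and nonzero: "Y j \<noteq> 0"
  shows "\<exists>s t. 1 \<le> s \<and> s < t \<and> t \<le> k \<and>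
    \<alpha> \<le> \<delta> + (m (Poly_Mapping.single (i s) 1) + m (Poly_Mapping.single (i t) 1))"
proof -
  obtain s where s: "s \<in> {1..k}" "Y (i s) \<noteq> 0"
    using supp[of j] nonzero by blast
  have "(\<Sum>t\<in>{1..k}. Y (i t) * pderiv_var (i t) f) = 0"
    using vf_apply_supported[of "{1..k}" i Y f] inj supp zero by simp
  from syzygy_degree_bound[where Q = "\<lambda>s. Y (i s)", OF add nonneg f regular Y this s]
  obtain t where t: "t \<in> {1..k}" "t \<noteq> s"
    "\<alpha> \<le> \<delta> + (m (Poly_Mapping.single (i s) 1) + m (Poly_Mapping.single (i t) 1))" .
  show ?thesis
  proof (cases "s < t")
    case True
    with s t show ?thesis by auto
  next
    case False
    with t(2) have "t < s" by simp
    with s t show ?thesis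
      by (intro exI[of _ t] exI[of _ s]) (auto simp: add.commute)
  qed
qed

section \<open>Multidegrees of monomials\<close>

lemma subgroup_principal_divisors: "subgroup (principal_divisors u) divisor_group"
proof
  show "principal_divisors u \<subseteq> carrier divisor_group"
    by (auto simp: divisor_group_def)
  show "x \<otimes>\<^bsub>divisor_group\<^esub> y \<in> principal_divisors u"
    if x: "x \<in> principal_divisors u" and y: "y \<in> principal_divisors u" for x y
  proof -
    obtain m where "Modules.additive m" "\<forall>j. Poly_Mapping.lookup x j = m (u j)"
      using x by (auto simp: principal_divisors_def)
    moreover obtain m' where "Modules.additive m'" "\<forall>j. Poly_Mapping.lookup y j = m' (u j)"
      using y by (auto simp: principal_divisors_def)
    ultimately show ?thesis
      by (auto simp: principal_divisors_def divisor_group_def lookup_add Modules.additive_def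
          intro!: exI[of _ "\<lambda>v. m v + m' v"])
  qed
  show "\<one>\<^bsub>divisor_group\<^esub> \<in> principal_divisors u"
    by (auto simp: principal_divisors_def divisor_group_def Modules.additive_def
          intro!: exI[of _ "\<lambda>v. 0"])
  show "inv\<^bsub>divisor_group\<^esub> x \<in> principal_divisors u" if x: "x \<in> principal_divisors u" for x
  proof -
    obtain m where "Modules.additive m" "\<forall>j. Poly_Mapping.lookup x j = m (u j)"
      using x by (auto simp: principal_divisors_def)
    then show ?thesis
      by (auto simp: principal_divisors_def divisor_group_def Modules.additive_def
          intro!: exI[of _ "\<lambda>v. - m v"])
  qed
qed

lemma comm_group_divisor_group: "comm_group divisor_group"
  by (simp add: divisor_group_def abelian_free_Abelian_group)

lemma divisor_class_in_carrier: "divisor_class u d \<in> carrier (class_group u)"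
  by (auto simp: class_group_def FactGroup_def divisor_class_def RCOSETS_def divisor_group_def)

lemma divisor_class_add:
  "divisor_class u (c + d) = divisor_class u c \<otimes>\<^bsub>class_group u\<^esub> divisor_class u d"
proof -
  interpret G: comm_group "divisor_group :: ('a \<Rightarrow>\<^sub>0 int) monoid"
    by (rule comm_group_divisor_group)
  interpret normal "principal_divisors u" divisor_group
    by (rule G.normal_iff_subgroup[THEN iffD2, OF subgroup_principal_divisors])
  have "x \<in> carrier divisor_group" for x :: "'a \<Rightarrow>\<^sub>0 int"
    by (simp add: divisor_group_def)
  then show ?thesis
    unfolding divisor_class_def class_group_def FactGroup_def
    using rcos_sum[of c d] by (simp add: divisor_group_def)
qed

lemma multidegree_mult:
  assumes "\<phi> \<in> hom (class_group u) (free_Abelian_group S \<times>\<times> T)"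
    and "a \<in> carrier (class_group u)" "b \<in> carrier (class_group u)"
  shows "multidegree \<phi> l (a \<otimes>\<^bsub>class_group u\<^esub> b) = multidegree \<phi> l a + multidegree \<phi> l b"
  using hom_mult[OF assms] by (simp add: multidegree_def mult_DirProd' lookup_add)

lemma map_int_add:
  "Poly_Mapping.map int (d + e) = Poly_Mapping.map int d + Poly_Mapping.map int e"
  by (rule poly_mapping_eqI) (auto simp: Poly_Mapping.map.rep_eq lookup_add when_def)

section \<open>Linear relations among the rays\<close>

text \<open>
  Independence of \<open>B\<close> gives a linear functional vanishing at \<open>v\<close> and equal to \<open>1\<close> on the other
  generators. It is nonnegative on the cone and cuts out a one-dimensional face through \<open>v\<close>, which
  is one of the rays of the fan.
\<close>

lemma basis_vector_span_rays:
  fixes u :: "'j \<Rightarrow> int ^ 'n::finite"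
  assumes "complete_simplicial_fan \<Delta> u"
    and B: "independent B" "convex_cone hull B \<in> \<Delta>" and v: "v \<in> B"
  shows "v \<in> span (range (\<lambda>j. real_vec (u j)))"
proof -
  let ?\<sigma> = "convex_cone hull B"
  obtain h :: "real ^ 'n \<Rightarrow> real" where lin: "linear h"
    and h: "\<And>w. w \<in> B \<Longrightarrow> h w = (if w = v then 0 else 1)"
    using linear_independent_extend[OF B(1), of "\<lambda>w. if w = v then 0 else 1"] by auto
  define c where "c = adjoint h 1"
  have c: "c \<bullet> w = h w" for w
    using adjoint_works[OF lin, of w 1] by (simp add: c_def inner_commute)
  let ?P = "{w. h w \<ge> 0 \<and> (h w = 0 \<longrightarrow> w \<in> span {v})}"
  have "convex_cone ?P"
    unfolding convex_cone_iff
    using linear_0[OF lin] linear_add[OF lin] linear_scale[OF lin]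
    by (auto simp: span_zero span_scale add_nonneg_eq_0_iff intro: span_add exI[of _ 0])
  moreover have "B \<subseteq> ?P"
    using h by (auto simp: span_base split: if_splits)
  ultimately have hull: "?\<sigma> \<subseteq> ?P"
    by (intro hull_minimal)
  let ?\<tau> = "?\<sigma> \<inter> {w. c \<bullet> w = 0}"
  have face: "?\<tau> face_of ?\<sigma>"
    using hull c by (intro face_of_Int_supporting_hyperplane_ge convex_convex_cone_hull) auto
  have v\<tau>: "v \<in> ?\<tau>" and 0: "0 \<in> ?\<tau>"
    using v h[OF v] c linear_0[OF lin] by (auto simp: hull_inc convex_cone_hull_contains_0)
  have "v \<noteq> 0"
    using B(1) v dependent_zero by blast
  have sub: "?\<tau> \<subseteq> span {v}"
    using hull c by auto
  have "span ?\<tau> = span {v}"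
    using v\<tau> sub by (simp add: span_eq span_base)
  then have "dim ?\<tau> = 1"
    using \<open>v \<noteq> 0\<close> by (metis dim_span dim_singleton dim_eq_0 One_nat_def)
  then have "aff_dim ?\<tau> = 1"
    using aff_dim_zero[of ?\<tau>] 0 by (simp add: hull_inc)
  moreover have "?\<tau> \<in> \<Delta>"
    using assms(1) B(2) face 0 unfolding complete_simplicial_fan_def fan_def by blast
  ultimately obtain j where "ray u j = ?\<tau>"
    using assms(1) unfolding complete_simplicial_fan_def ray_generators_def bij_betw_def
    by (metis (mono_tags, lifting) imageE mem_Collect_eq)
  then have "v \<in> convex_cone hull {real_vec (u j)}"
    using v\<tau> by (simp add: ray_def)
  also have "\<dots> \<subseteq> span {real_vec (u j)}"
    by (intro hull_minimal convex_cone_span) (auto intro: span_base)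
  also have "\<dots> \<subseteq> span (range (\<lambda>j. real_vec (u j)))"
    by (intro span_mono) auto
  finally show ?thesis .
qed

text \<open>
  By completeness the cones cover the space, and each of them is generated by multiples of ray
  generators.
\<close>

lemma span_rays:
  fixes u :: "'j \<Rightarrow> int ^ 'n::finite"
  assumes "complete_simplicial_fan \<Delta> u"
  shows "span (range (\<lambda>j. real_vec (u j))) = UNIV"
proof -
  have "v \<in> span (range (\<lambda>j. real_vec (u j)))" for v
  proof -
    obtain \<sigma> where \<sigma>: "\<sigma> \<in> \<Delta>" "v \<in> \<sigma>"
      using assms by (auto simp: complete_simplicial_fan_def complete_fan_def)
    then obtain B where B: "independent B" "\<sigma> = convex_cone hull B"
      using assms by (auto simp: complete_simplicial_fan_def simplicial_def)
    have "convex_cone hull B \<subseteq> span (range (\<lambda>j. real_vec (u j)))"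
      using basis_vector_span_rays[OF assms] B \<sigma> by (intro hull_minimal convex_cone_span) auto
    with \<sigma> B show ?thesis by auto
  qed
  then show ?thesis by auto
qed

text \<open>
  The relations are the orthogonal complement of the row space of the matrix with columns \<open>v j\<close>,
  and the row rank equals the column rank.
\<close>

lemma dim_relations:
  fixes v :: "'j::finite \<Rightarrow> real ^ 'n::finite"
  assumes "span (range v) = UNIV"
  shows "dim {a :: real ^ 'j. (\<Sum>j\<in>UNIV. (a $ j) *\<^sub>R v j) = 0} + CARD('n) = CARD('j)"
proof -
  define A :: "real ^ 'j ^ 'n" where "A = (\<chi> t j. v j $ t)"
  have "columns A = range v"
    by (auto simp: columns_def column_def A_def vec_lambda_eta)
  then have rank: "dim (rows A) = CARD('n)"
    using assms by (metis row_rank_def column_rank_def dim_span dim_UNIV DIM_cart DIM_real mult.right_neutral)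
  have "{a. (\<Sum>j\<in>UNIV. (a $ j) *\<^sub>R v j) = 0} = {y \<in> UNIV. \<forall>x\<in>span (rows A). orthogonal x y}"
    (is "?K = ?L")
  proof -
    have "rows A = range (\<lambda>t. \<chi> j. v j $ t)"
      by (auto simp: rows_def row_def A_def vec_lambda_eta)
    then have "a \<in> ?K \<longleftrightarrow> (\<forall>x\<in>rows A. orthogonal a x)" for a
      by (auto simp: orthogonal_def inner_vec_def vec_eq_iff)
    also have "(\<forall>x\<in>rows A. orthogonal a x) \<longleftrightarrow> (\<forall>x\<in>span (rows A). orthogonal a x)" for a
      by (meson orthogonal_to_span span_base)
    finally show ?thesis
      by (auto simp: orthogonal_commute)
  qed
  then show ?thesis
    using dim_subspace_orthogonal_to_vectors[of "span (rows A)" UNIV] rank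
    by simp
qed

lemma common_denominator:
  fixes q :: "'l \<Rightarrow> rat"
  assumes "finite L"
  shows "\<exists>N::int. N \<noteq> 0 \<and> (\<forall>l\<in>L. \<exists>z::int. of_int N * q l = of_int z)"
  using assms
proof induction
  case empty
  then show ?case by (auto intro: exI[of _ 1])
next
  case (insert l L)
  then obtain N where N: "N \<noteq> 0" "\<forall>l\<in>L. \<exists>z::int. of_int N * q l = of_int z"
    by blast
  obtain a b where q: "q l = of_int a / of_int b" "b \<noteq> 0"
    by (cases "q l") (auto simp: Fract_of_int_quotient)
  have "\<exists>z::int. of_int (b * N) * q l' = of_int z" if l': "l' \<in> insert l L" for l'
  proof (cases "l' = l")
    case True
    then have "of_int (b * N) * q l' = of_int (N * a)"
      using q by simp
    then show ?thesis by blast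
  next
    case False
    then obtain z where "of_int N * q l' = of_int z" using N l' by auto
    then have "of_int (b * N) * q l' = of_int (b * z)" by simp
    then show ?thesis by blast
  qed
  then show ?case
    using N q by (intro exI[of _ "b * N"]) auto
qed

text \<open>
  A \<open>\<rat>\<close>-linear functional \<open>\<real> \<Rightarrow> \<rat>\<close> that does not kill \<open>c l\<close> turns a real relation among integer
  vectors into a rational one whose \<open>l\<close>-th coefficient is nonzero; clearing denominators makes it
  integral.
\<close>

lemma int_independent_imp_real_independent:
  fixes b :: "'l \<Rightarrow> 'j \<Rightarrow> int" and c :: "'l \<Rightarrow> real"
  assumes L: "finite L"
    and indep: "\<And>c :: 'l \<Rightarrow> int. (\<And>j. (\<Sum>l\<in>L. c l * b l j) = 0) \<Longrightarrow> \<forall>l\<in>L. c l = 0"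
    and c: "\<And>j. (\<Sum>l\<in>L. c l * of_int (b l j)) = 0" and l: "l \<in> L"
  shows "c l = 0"
proof (rule ccontr)
  assume cl: "c l \<noteq> 0"
  \<comment> \<open>\<open>\<real>\<close> as a vector space over \<open>\<rat>\<close>\<close>
  interpret R: vector_space "\<lambda>(q::rat) (x::real). of_rat q * x"
    by unfold_locales (auto simp: algebra_simps of_rat_add of_rat_mult)
  interpret Q: vector_space "(*) :: rat \<Rightarrow> rat \<Rightarrow> rat"
    by unfold_locales (auto simp: algebra_simps)
  interpret RQ: vector_space_pair "\<lambda>(q::rat) (x::real). of_rat q * x" "(*) :: rat \<Rightarrow> rat \<Rightarrow> rat" ..
  have "R.independent {c l}"
    using cl by simp
  from RQ.linear_independent_extend[OF this, of "\<lambda>_. 1"]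
  obtain h where h: "Vector_Spaces.linear (\<lambda>(q::rat) (x::real). of_rat q * x) (*) h" "h (c l) = 1"
    by auto
  interpret h: Vector_Spaces.linear "\<lambda>(q::rat) (x::real). of_rat q * x" "(*)" h
    by (rule h(1))
  have hsum: "(\<Sum>l\<in>L. of_int (b l j) * h (c l)) = 0" for j
  proof -
    have "(\<Sum>l\<in>L. of_int (b l j) * h (c l)) = (\<Sum>l\<in>L. h (of_rat (of_int (b l j)) * c l))"
      by (simp only: h.scale)
    also have "\<dots> = h (\<Sum>l\<in>L. c l * of_int (b l j))"
      by (simp add: h.sum mult.commute)
    finally show ?thesis using c by (simp add: h.zero)
  qed
  obtain N :: int where N: "N \<noteq> 0" "\<forall>l\<in>L. \<exists>z::int. of_int N * h (c l) = of_int z"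
    using common_denominator[OF L, of "\<lambda>l. h (c l)"] by blast
  then obtain z :: "'l \<Rightarrow> int" where z: "\<And>l. l \<in> L \<Longrightarrow> of_int N * h (c l) = of_int (z l)"
    using bchoice[OF N(2)] by auto
  have "(\<Sum>l\<in>L. z l * b l j) = 0" for j
  proof -
    have "rat_of_int (\<Sum>l\<in>L. z l * b l j) = (\<Sum>l\<in>L. of_int N * h (c l) * of_int (b l j))"
      by (simp add: z)
    also have "\<dots> = of_int N * (\<Sum>l\<in>L. of_int (b l j) * h (c l))"
      by (simp add: sum_distrib_left mult_ac)
    finally show ?thesis using hsum by (simp only: mult_zero_right of_int_eq_0_iff)
  qed
  then have "z l = 0"
    using indep l by blast
  with z[OF l] N h(2) show False by simp
qed

text \<open>
  The \<open>r\<close> integer relations \<open>b\<^sub>l\<close> stay independent over \<open>\<real>\<close>, and the space of all real relations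
  has dimension \<open>(n + r) - n = r\<close>, so they span it.
\<close>

lemma relation_real_combination:
  fixes u :: "'j::finite \<Rightarrow> int ^ 'n::finite" and a :: "'j \<Rightarrow> real"
  assumes fan: "complete_simplicial_fan \<Delta> u" and card: "CARD('j) = CARD('n) + r"
    and radial: "radial_basis u r b"
    and a: "\<And>t. (\<Sum>j\<in>UNIV. a j * of_int (u j $ t)) = 0"
  shows "\<exists>c. \<forall>j. a j = (\<Sum>l\<in>{1..r}. c l * of_int (b l j))"
proof -
  define v where "v l = (\<chi> j. real_of_int (b l j))" for l
  let ?K = "{a :: real ^ 'j. (\<Sum>j\<in>UNIV. (a $ j) *\<^sub>R real_vec (u j)) = 0}"
  have dim: "dim ?K = r"
    using dim_relations[OF span_rays[OF fan]] card by simp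
  have indep: "c l = 0" if "(\<Sum>l\<in>{1..r}. c l *\<^sub>R v l) = 0" "l \<in> {1..r}" for c l
  proof (rule int_independent_imp_real_independent[of "{1..r}" b c])
    show "\<forall>l\<in>{1..r}. c l = 0" if "\<And>j. (\<Sum>l\<in>{1..r}. c l * b l j) = 0" for c :: "nat \<Rightarrow> int"
      using radial that by (auto simp: radial_basis_def)
    show "(\<Sum>l\<in>{1..r}. c l * of_int (b l j)) = 0" for j
      using arg_cong[OF that(1), of "\<lambda>w. w $ j"] by (simp add: v_def)
  qed (use that in auto)
  have inj: "inj_on v {1..r}"
  proof (rule inj_onI, rule ccontr)
    fix l l' assume l: "l \<in> {1..r}" "l' \<in> {1..r}" "v l = v l'" "l \<noteq> l'"
    let ?c = "\<lambda>i. (if i = l then 1 else 0) - (if i = l' then 1 else 0) :: real"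
    have "(\<Sum>i\<in>{1..r}. ?c i *\<^sub>R v i)
        = (\<Sum>i\<in>{1..r}. if i = l then v i else 0) - (\<Sum>i\<in>{1..r}. if i = l' then v i else 0)"
      unfolding sum_subtractf[symmetric] by (rule sum.cong) (auto simp: algebra_simps)
    also have "\<dots> = 0"
      using l by simp
    finally have "?c l = 0" using indep[of ?c l] l by blast
    with l show False by simp
  qed
  have "independent (v ` {1..r})"
  proof
    assume "dependent (v ` {1..r})"
    then obtain w where w: "(\<Sum>x\<in>v ` {1..r}. w x *\<^sub>R x) = 0" "\<exists>x\<in>v ` {1..r}. w x \<noteq> 0"
      by (auto simp: dependent_finite)
    from w(1) inj have "(\<Sum>l\<in>{1..r}. w (v l) *\<^sub>R v l) = 0"
      by (simp add: sum.reindex)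
    with indep[of "\<lambda>l. w (v l)"] w(2) show False by auto
  qed
  moreover have "v ` {1..r} \<subseteq> ?K"
  proof (intro image_subsetI CollectI)
    fix l assume "l \<in> {1..r}"
    then have *: "(\<Sum>j\<in>UNIV. b l j *s u j) = 0"
      using radial by (auto simp: radial_basis_def)
    have "(\<Sum>j\<in>UNIV. b l j * (u j $ t)) = 0" for t
      using arg_cong[OF *, of "\<lambda>w. w $ t"] by simp
    then have "(\<Sum>j\<in>UNIV. real_of_int (b l j) * real_of_int (u j $ t)) = 0" for t
      by (metis (mono_tags, lifting) of_int_0 of_int_mult of_int_sum sum.cong)
    then show "(\<Sum>j\<in>UNIV. (v l $ j) *\<^sub>R real_vec (u j)) = 0"
      by (simp add: vec_eq_iff v_def real_vec_def)
  qed
  ultimately have "?K \<subseteq> span (v ` {1..r})"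
    using dim inj by (intro card_ge_dim_independent) (auto simp: card_image)
  moreover have "(\<chi> j. a j) \<in> ?K"
    using a by (simp add: vec_eq_iff real_vec_def)
  ultimately obtain w where "(\<chi> j. a j) = (\<Sum>x\<in>v ` {1..r}. w x *\<^sub>R x)"
    unfolding span_finite[OF finite_imageI[OF finite_atLeastAtMost]] by blast
  then have *: "(\<chi> j. a j) = (\<Sum>l\<in>{1..r}. w (v l) *\<^sub>R v l)"
    using inj by (simp add: sum.reindex)
  have "a j = (\<Sum>l\<in>{1..r}. w (v l) * of_int (b l j))" for j
    using arg_cong[OF *, of "\<lambda>x. x $ j"] by (simp add: v_def)
  then show ?thesis by (intro exI[of _ "\<lambda>l. w (v l)"]) auto
qed

text \<open>
  Radial fields are given by complex relations; their real and imaginary parts are real relations.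
  Consequently every \<open>S\<close>-multiple of a radial field lies in \<open>Lie(G)\<close>.
\<close>

lemma ray_relation_combination:
  fixes u :: "'j::finite \<Rightarrow> int ^ 'n::finite" and a :: "'j \<Rightarrow> complex"
  assumes "complete_simplicial_fan \<Delta> u" "CARD('j) = CARD('n) + r" "radial_basis u r b"
    and a: "ray_relation u a"
  shows "\<exists>c. \<forall>j. a j = (\<Sum>l\<in>{1..r}. c l * of_int (b l j))"
proof -
  have *: "(\<Sum>j\<in>UNIV. Re (a j) * of_int (u j $ t)) = 0"
    "(\<Sum>j\<in>UNIV. Im (a j) * of_int (u j $ t)) = 0" for t
    using arg_cong[OF a[unfolded ray_relation_def, rule_format, of t], of Re]
      arg_cong[OF a[unfolded ray_relation_def, rule_format, of t], of Im] by auto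
  obtain p where p: "\<And>j. Re (a j) = (\<Sum>l\<in>{1..r}. p l * of_int (b l j))"
    using relation_real_combination[OF assms(1-3) *(1)] by blast
  obtain q where q: "\<And>j. Im (a j) = (\<Sum>l\<in>{1..r}. q l * of_int (b l j))"
    using relation_real_combination[OF assms(1-3) *(2)] by blast
  show ?thesis
    by (intro exI[of _ "\<lambda>l. Complex (p l) (q l)"] allI complex_eqI) (simp_all add: p q)
qed

section \<open>The degree bound\<close>

theorem theorem1p2:
  fixes \<Delta> :: "(real ^ 'n::finite) set set"
    and u :: "'j::{finite,linorder} \<Rightarrow> int ^ 'n"
    and r k :: nat
    and b :: "nat \<Rightarrow> 'j \<Rightarrow> int"
    and T :: "'t monoid"
    and \<phi> :: "('j \<Rightarrow>\<^sub>0 int) set \<Rightarrow> (nat \<Rightarrow>\<^sub>0 int) \<times> 't"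
    and F :: "'j vfield set"
    and \<alpha> \<beta> :: "('j \<Rightarrow>\<^sub>0 int) set"
    and X X1 X2 :: "'j vfield"
    and f :: "'j cpoly"
    and i :: "nat \<Rightarrow> 'j"
  assumes fan: "complete_simplicial_fan \<Delta> u"
    and card_rays: "CARD('j) = CARD('n) + r"
    and splitting: "comm_group T" "finite (carrier T)"
      "\<phi> \<in> iso (class_group u) (free_Abelian_group {1..r} \<times>\<times> T)"
    and radial: "radial_basis u r b"
    and foliation: "foliation \<Delta> u r b \<beta> F" "X \<in> F"
    and hypersurface: "\<alpha> \<in> carrier (class_group u)" "f \<in> graded_piece u \<alpha>" "f \<noteq> 0"
      "quasi_smooth \<Delta> u f"
    and indices: "strict_mono_on {1..k} i"
    and regular: "regular_sequence (map (\<lambda>s. pderiv_var (i s) f) [1..<Suc k])"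
    and euler: "\<exists>a \<theta>. ray_relation u a \<and> (\<exists>j. a j \<noteq> 0) \<and> (\<forall>j. j \<notin> i ` {1..k} \<longrightarrow> a j = 0) \<and>
      vf_apply (radial_vf a) f = const \<theta> * f"
    and decomposition: "X = (\<lambda>j. X1 j + X2 j)" "quasi_homogeneous_vf u \<beta> X1"
      "\<forall>j. j \<notin> i ` {1..k} \<longrightarrow> X1 j = 0"
    and invariant: "leaves_invariant u X1 f"
    and not_Lie: "X1 \<notin> Lie_G r b"
  shows "\<forall>l\<in>{1..r}.
    (\<forall>\<gamma>\<in>carrier (class_group u). \<forall>P\<in>graded_piece u \<gamma>. P \<noteq> 0 \<longrightarrow> multidegree \<phi> l \<gamma> \<ge> 0) \<longrightarrow>
    multidegree \<phi> l \<alpha> \<le> multidegree \<phi> l \<beta> +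
      Max {multidegree \<phi> l (coord_class u (i s)) + multidegree \<phi> l (coord_class u (i t)) |s t.
             1 \<le> s \<and> s < t \<and> t \<le> k}"
proof (intro ballI impI)
  fix l
  assume "l \<in> {1..r}" and eff: "\<forall>\<gamma>\<in>carrier (class_group u). \<forall>P\<in>graded_piece u \<gamma>. P \<noteq> 0 \<longrightarrow>
    multidegree \<phi> l \<gamma> \<ge> 0"
  let ?z = "\<lambda>j. multidegree \<phi> l (coord_class u j)"
  let ?\<alpha> = "multidegree \<phi> l \<alpha>" and ?\<beta> = "multidegree \<phi> l \<beta>"
  define m where "m e = multidegree \<phi> l (divisor_class u (Poly_Mapping.map int e))" for e
  have hom: "\<phi> \<in> hom (class_group u) (free_Abelian_group {1..r} \<times>\<times> T)"
    using splitting(3) by (simp add: iso_def)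
  have \<beta>: "\<beta> \<in> carrier (class_group u)"
    using foliation(1) by (simp add: foliation_def)
  have add: "m (d + e) = m d + m e" for d e
    unfolding m_def map_int_add divisor_class_add
    by (rule multidegree_mult[OF hom divisor_class_in_carrier divisor_class_in_carrier])
  \<comment> \<open>the monomial \<open>z\<^sup>e\<close> is itself a nonzero element of its graded piece\<close>
  have nonneg: "0 \<le> m e" for e
  proof -
    have "Poly_Mapping.single e 1 \<in> graded_piece u (divisor_class u (Poly_Mapping.map int e))"
      by (simp add: graded_piece_def)
    moreover have "Poly_Mapping.single e (1::complex) \<noteq> 0"
      by (metis lookup_single_eq lookup_zero one_neq_zero)
    ultimately show ?thesis
      using eff divisor_class_in_carrier unfolding m_def by blast
  qed
  have m_var: "m (Poly_Mapping.single j 1) = ?z j" for j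
    by (simp add: m_def coord_class_def)
  have m_graded: "m e = multidegree \<phi> l \<gamma>" if "p \<in> graded_piece u \<gamma>" "e \<in> Poly_Mapping.keys p" for e p \<gamma>
    using that by (simp add: m_def graded_piece_def)
  have m_f: "m e = ?\<alpha>" if "e \<in> Poly_Mapping.keys f" for e
    using m_graded[OF hypersurface(2) that] .
  have m_X1: "m e = ?\<beta> + m (Poly_Mapping.single j 1)" if "e \<in> Poly_Mapping.keys (X1 j)" for e j
  proof -
    have "X1 j \<in> graded_piece u (\<beta> \<otimes>\<^bsub>class_group u\<^esub> coord_class u j)"
      using decomposition(2) by (simp add: quasi_homogeneous_vf_def)
    from m_graded[OF this that] show ?thesis
      using multidegree_mult[OF hom \<beta> divisor_class_in_carrier] m_var
      by (simp add: coord_class_def)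
  qed
  have inj: "inj_on i {1..k}"
    using indices by (rule strict_mono_on_imp_inj_on)
  note bound = annihilating_field_degree_bound[where m = m, OF add nonneg m_f regular inj]
  obtain g \<gamma> where g: "vf_apply X1 f = g * f" "g \<in> graded_piece u \<gamma>"
    using invariant by (auto simp: leaves_invariant_def quasi_homogeneous_def)
  obtain a \<theta> where a: "ray_relation u a" "\<exists>j. a j \<noteq> 0" "\<forall>j. j \<notin> i ` {1..k} \<longrightarrow> a j = 0"
    "vf_apply (radial_vf a) f = const \<theta> * f"
    using euler by blast
  have "\<exists>s t. 1 \<le> s \<and> s < t \<and> t \<le> k \<and>
    ?\<alpha> \<le> ?\<beta> + (m (Poly_Mapping.single (i s) 1) + m (Poly_Mapping.single (i t) 1))"
  proof (cases "g * f = 0")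
    case True
    have "\<exists>j. X1 j \<noteq> 0"
    proof (rule ccontr)
      assume "\<not> (\<exists>j. X1 j \<noteq> 0)"
      then have "X1 \<in> Lie_G r b"
        unfolding Lie_G_def by (intro CollectI exI[of _ "\<lambda>_. 0"]) auto
      with not_Lie show False ..
    qed
    then obtain j where "X1 j \<noteq> 0" ..
    with bound[where Y = X1] m_X1 decomposition(3) g(1) True show ?thesis by auto
  next
    case False
    then obtain e where e: "e \<in> Poly_Mapping.keys (g * f)"
      by (metis all_not_in_conv keys_eq_empty)
    obtain d d' where d: "d \<in> Poly_Mapping.keys g" "d' \<in> Poly_Mapping.keys f" "e = d + d'"
      using e keys_mult[of g f] by blast
    obtain j c c' where c: "c \<in> Poly_Mapping.keys (X1 j)" "c' \<in> Poly_Mapping.keys (pderiv_var j f)"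
      "e = c + c'"
      using keys_sum_of_products[of e X1 "\<lambda>j. pderiv_var j f" UNIV] e
      unfolding g(1)[symmetric] vf_apply_def by blast
    have "m c' + m (Poly_Mapping.single j 1) = ?\<alpha>"
      using m_f[OF keys_pderiv_var[OF c(2)]] add by simp
    \<comment> \<open>the same monomial of \<open>X\<^sub>1(f) = g f\<close> has degree \<open>deg \<F> + deg f\<close> and \<open>deg g + deg f\<close>\<close>
    then have \<beta>: "m d = ?\<beta>"
      using m_X1[OF c(1)] m_f[OF d(2)] add[of d d'] add[of c c'] c(3) d(3) by simp
    have m_g: "m e = ?\<beta>" if "e \<in> Poly_Mapping.keys g" for e
      using m_graded[OF g(2) that] m_graded[OF g(2) d(1)] \<beta> by simp
    have keys_R: "Poly_Mapping.keys (radial_vf a j) \<subseteq> {Poly_Mapping.single j 1}" for j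
      by (simp add: radial_vf_eq_single)
    show ?thesis
    proof (cases "\<theta> = 0")
      case True
      \<comment> \<open>the radial field itself annihilates \<open>f\<close> and has degree \<open>0\<close>, while \<open>g \<noteq> 0\<close>
        forces \<open>deg \<F> = deg g \<ge> 0\<close>\<close>
      obtain j where "a j \<noteq> 0" using a(2) ..
      then have "radial_vf a j \<noteq> 0"
        by (metis radial_vf_eq_single lookup_single_eq lookup_zero)
      moreover have "vf_apply (radial_vf a) f = 0"
        using a(4) True by (simp add: const_def)
      moreover have "radial_vf a j = 0" if "j \<notin> i ` {1..k}" for j
        using a(3) that by (simp add: radial_vf_eq_single)
      moreover have "m e = 0 + m (Poly_Mapping.single j 1)" if "e \<in> Poly_Mapping.keys (radial_vf a j)" for e j
        using keys_R[of j] that by auto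
      ultimately have "\<exists>s t. 1 \<le> s \<and> s < t \<and> t \<le> k \<and>
        ?\<alpha> \<le> 0 + (m (Poly_Mapping.single (i s) 1) + m (Poly_Mapping.single (i t) 1))"
        using bound[where Y = "radial_vf a" and \<delta> = 0] by blast
      moreover have "0 \<le> ?\<beta>"
        using nonneg[of d] \<beta> by simp
      ultimately show ?thesis by force
    next
      case False
      \<comment> \<open>subtracting the multiple \<open>(g/\<theta>) R\<close> of the radial field cancels \<open>g f\<close>\<close>
      define h where "h = const (1 / \<theta>) * g"
      define Y where "Y j = X1 j - h * radial_vf a j" for j
      have "const (1 / \<theta>) * const \<theta> = (1 :: 'j cpoly)"
        using False by (simp add: const_def mult_single)
      moreover have "h * (const \<theta> * f) = const (1 / \<theta>) * const \<theta> * (g * f)"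
        by (simp add: h_def mult_ac)
      ultimately have "h * (const \<theta> * f) = g * f"
        by simp
      then have zero: "vf_apply Y f = 0"
        unfolding Y_def vf_apply_diff_mult by (simp only: g(1) a(4) diff_self)
      have supp: "Y j = 0" if "j \<notin> i ` {1..k}" for j
        using that a(3) decomposition(3) by (simp add: Y_def radial_vf_eq_single)
      have m_Y: "m e = ?\<beta> + m (Poly_Mapping.single j 1)" if e: "e \<in> Poly_Mapping.keys (Y j)" for e j
      proof -
        have "e \<in> Poly_Mapping.keys (X1 j) \<or> e \<in> Poly_Mapping.keys (h * radial_vf a j)"
          using e keys_diff[of "X1 j" "h * radial_vf a j"] unfolding Y_def by blast
        then show ?thesis
        proof
          assume "e \<in> Poly_Mapping.keys (h * radial_vf a j)"
          then obtain p p' where p: "p \<in> Poly_Mapping.keys h" "p' \<in> Poly_Mapping.keys (radial_vf a j)" "e = p + p'"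
            using keys_mult[of h "radial_vf a j"] by blast
          have "p \<in> Poly_Mapping.keys g" "p' = Poly_Mapping.single j 1"
            using p(1,2) keys_const_mult[of "1 / \<theta>" g] keys_R[of j] by (auto simp: h_def)
          then show ?thesis
            using m_g p(3) add by simp
        qed (rule m_X1)
      qed
      have "\<exists>j. Y j \<noteq> 0"
      proof (rule ccontr)
        assume "\<not> (\<exists>j. Y j \<noteq> 0)"
        then have X1: "X1 j = h * radial_vf a j" for j
          by (simp add: Y_def)
        obtain c where c: "\<And>j. a j = (\<Sum>l\<in>{1..r}. c l * of_int (b l j))"
          using ray_relation_combination[OF fan card_rays radial a(1)] by blast
        have "radial_vf a j = (\<Sum>l\<in>{1..r}. const (c l) * radial_vf (\<lambda>j. of_int (b l j)) j)" for j
          unfolding radial_vf_eq_single const_def mult_single c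
          by (rule poly_mapping_eqI) (simp add: lookup_sum lookup_single when_def)
        then have "X1 = (\<lambda>j. \<Sum>l\<in>{1..r}. (h * const (c l)) * radial_vf (\<lambda>j. of_int (b l j)) j)"
          by (simp add: fun_eq_iff X1 sum_distrib_left mult.assoc)
        then have "X1 \<in> Lie_G r b"
          unfolding Lie_G_def by (intro CollectI exI[of _ "\<lambda>l. h * const (c l)"]) simp
        with not_Lie show False ..
      qed
      then obtain j where "Y j \<noteq> 0" ..
      with bound[where Y = Y and \<delta> = ?\<beta> and j = j] supp m_Y zero show ?thesis by blast
    qed
  qed
  then obtain s t where st: "1 \<le> s" "s < t" "t \<le> k" "?\<alpha> \<le> ?\<beta> + (?z (i s) + ?z (i t))"
    unfolding m_var by blast
  let ?M = "{?z (i s) + ?z (i t) |s t. 1 \<le> s \<and> s < t \<and> t \<le> k}"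
  have "?M \<subseteq> (\<lambda>(s, t). ?z (i s) + ?z (i t)) ` ({1..k} \<times> {1..k})"
    by force
  then have "finite ?M"
    by (rule finite_subset) simp
  then have "?z (i s) + ?z (i t) \<le> Max ?M"
    using st by (intro Max_ge) blast+
  with st(4) show "?\<alpha> \<le> ?\<beta> + Max ?M"
    by linarith
qed

end
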